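(* Let $F:\mathbb{R}^n\times\mathbb{R}^m\to\mathbb{R}^n$ be $C^1$ with $F(0,0)=0$, and suppose that all second order partial derivatives of the components of $F(x,u)$ with respect to the components of $u$ exist and are continuous. Consider the control system $\dot x=F(x,u)$ with state $x\in\mathbb{R}^n$ and control $u\in\mathbb{R}^m$, and set $f(x)=F(x,0)$ and $g(x)=\frac{\partial F}{\partial u}(x,0)$. Assume: (A1) $V:\mathbb{R}^n\to\mathbb{R}$ is a smooth, positive definite, radially unbounded function such that $L_fV(x)\le 0$ for all $x\in\mathbb{R}^n$. (A2) $G:\mathbb{R}^n\to\mathbb{R}^n$ is a (sufficiently smooth) vector field such that for every $x\neq 0$ with $L_gV(x)=0$, either $L_fL_GV(x)<0$ or $L_fV(x)<0$. Then there exist a positive definite smooth function $\delta:[0,\infty)\to[0,\infty)$ and a function $\Omega:[0,\infty)\to[0,\infty)$ such that $$V^\sharp(x)=V(x)+\int_0^{V(x)}\Omega(s)\,ds+\delta(V(x))\,L_GV(x)$$ is a control-Lyapunov function for $\dot x=F(x,u)$ that satisfies the small control property. In fact, for each $C^1$ function $\bar\xi:[0,\infty)\to(0,\infty)$ there exist a positive definite smooth function $\delta:[0,\infty)\to[0,\infty)$, a function $\Omega:[0,\infty)\to[0,\infty)$ and a $C^1$ function $\xi:[0,\infty)\to(0,\infty)$ with $\xi(s)\le\bar\xi(s)$ for all $s\ge 0$, such that the corresponding function $V^\sharp(x)=V(x)+\int_0^{V(x)}\Omega(s)\,ds+\delta(V(x))\,L_GV(x)$ is a control-Lyapunov function for $\dot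 x=F(x,u)$ satisfying the small control property, and its derivative along the trajectories of $\dot x=F(x,u)$ in closed loop with the feedback $u=-\xi(V(x))\,L_gV(x)^\top$ is negative definite, i.e. the function $x\mapsto\nabla V^\sharp(x)\,F\big(x,-\xi(V(x))L_gV(x)^\top\big)$ is negative definite.
   Context: Notation: $\nabla V$ is the gradient as a row vector. For a vector field $f$, $L_fV(x)=\nabla V(x)f(x)$; for an $n\times m$ matrix-valued function $g=(g_1,\dots,g_m)$, $L_gV(x)=\nabla V(x)g(x)=(L_{g_1}V(x),\dots,L_{g_m}V(x))$ is a row vector; $L_fL_GV=L_f(L_GV)$. A function is positive definite if it vanishes at $0$ and is positive elsewhere; it is negative definite if its negative is positive definite. A function $W:\mathbb{R}^n\to\mathbb{R}$ is radially unbounded if $W(x)\to+\infty$ as $|x|\to\infty$. All functions are assumed sufficiently smooth for the expressions involved to make sense; in particular $G$ is at least $C^1$. Control-Lyapunov function (CLF): a $C^1$, positive definite, radially unbounded function $W:\mathbb{R}^n\to\mathbb{R}$ such that for every $x\ne0$ there is $u\in\mathbb{R}^m$ with $\nabla W(x)F(x,u)<0$. (For control-affine systems $\dot x=\varphi_1(x)+\varphi_2(x)u$ this is equivalent to: $L_{\varphi_1}W(x)\ge0$ implies $x=0$ or $L_{\varphi_2}W(x)\ne0$.) Small control property of a CLF $W$: for each $\varepsilon>0$ there is $\eta>0$ such that for every $x$ with $0<|x|<\eta$ there is $u\in\mathbb{R}^m$ (possibly depending on $x$) with $|u|<\varepsilon$ and $\nabla W(x)F(x,u)<0$. *)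

theory Defs
  imports "HOL-Analysis.Analysis"
begin

(* Functions of class C^k on S, in terms of continuous iterated directional derivatives. It is
   only applied to sets S on which the Frechet derivative within S is unique (the whole space
   and the half-line {0..}, where the derivative at 0 is one-sided), so that the witness f' is
   the derivative. *)
fun Ck_on :: "nat \<Rightarrow> 'a::euclidean_space set \<Rightarrow> ('a \<Rightarrow> 'b::real_normed_vector) \<Rightarrow> bool" where
  "Ck_on 0 S f \<longleftrightarrow> continuous_on S f"
| "Ck_on (Suc k) S f \<longleftrightarrow>
     (\<exists>f'. (\<forall>x\<in>S. (f has_derivative f' x) (at x within S)) \<and> (\<forall>v. Ck_on k S (\<lambda>x. f' x v)))"

definition smooth_on :: "'a::euclidean_space set \<Rightarrow> ('a \<Rightarrow> 'b::real_normed_vector) \<Rightarrow> bool" where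
  "smooth_on S f \<longleftrightarrow> (\<forall>k. Ck_on k S f)"

(* All second order partial derivatives of the components of F x u with respect to the components
   of u exist and are continuous in (x, u): P i j is the partial derivative of the i-th component
   with respect to u_j, and Q i j k is the partial derivative of P i j with respect to u_k. *)
definition C2_in_control :: "(real^'n \<Rightarrow> real^'m \<Rightarrow> real^'n) \<Rightarrow> bool" where
  "C2_in_control F \<longleftrightarrow> (\<exists>P Q.
     (\<forall>i j x u. ((\<lambda>t. F x (u + t *\<^sub>R axis j 1) $ i) has_real_derivative P i j x u) (at 0)) \<and>
     (\<forall>i j k x u. ((\<lambda>t. P i j x (u + t *\<^sub>R axis k 1)) has_real_derivative Q i j k x u) (at 0)) \<and>
     (\<forall>i j k. continuous_on UNIV (\<lambda>(x, u). Q i j k x u)))"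

definition positive_definite :: "('a::zero \<Rightarrow> real) \<Rightarrow> bool" where
  "positive_definite W \<longleftrightarrow> W 0 = 0 \<and> (\<forall>x. x \<noteq> 0 \<longrightarrow> W x > 0)"

definition negative_definite :: "('a::zero \<Rightarrow> real) \<Rightarrow> bool" where
  "negative_definite W \<longleftrightarrow> positive_definite (\<lambda>x. - W x)"

(* Functions on [0,oo) are represented by functions on the reals whose values at negative
   arguments are irrelevant. *)
definition positive_definite_halfline :: "(real \<Rightarrow> real) \<Rightarrow> bool" where
  "positive_definite_halfline \<delta> \<longleftrightarrow> \<delta> 0 = 0 \<and> (\<forall>s>0. \<delta> s > 0)"

definition radially_unbounded :: "('a::real_normed_vector \<Rightarrow> real) \<Rightarrow> bool" where
  "radially_unbounded W \<longleftrightarrow> filterlim W at_top at_infinity"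

(* Row vectors and column vectors are both elements of real^'n. *)
definition grad :: "(real^'n \<Rightarrow> real) \<Rightarrow> real^'n \<Rightarrow> real^'n" where
  "grad V x = (\<chi> i. frechet_derivative V (at x) (axis i 1))"

definition lie :: "(real^'n \<Rightarrow> real^'n) \<Rightarrow> (real^'n \<Rightarrow> real) \<Rightarrow> real^'n \<Rightarrow> real" where
  "lie f V x = grad V x \<bullet> f x"

definition lie_mat :: "(real^'n \<Rightarrow> real^'m^'n) \<Rightarrow> (real^'n \<Rightarrow> real) \<Rightarrow> real^'n \<Rightarrow> real^'m" where
  "lie_mat g V x = grad V x v* g x"

definition drift :: "(real^'n \<Rightarrow> real^'m \<Rightarrow> real^'n) \<Rightarrow> real^'n \<Rightarrow> real^'n" where
  "drift F x = F x 0"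

definition input_matrix :: "(real^'n \<Rightarrow> real^'m \<Rightarrow> real^'n) \<Rightarrow> real^'n \<Rightarrow> real^'m^'n" where
  "input_matrix F x = jacobian (F x) (at 0)"

definition control_lyapunov ::
    "(real^'n \<Rightarrow> real^'m \<Rightarrow> real^'n) \<Rightarrow> (real^'n \<Rightarrow> real) \<Rightarrow> bool" where
  "control_lyapunov F W \<longleftrightarrow>
     Ck_on 1 UNIV W \<and> positive_definite W \<and> radially_unbounded W \<and>
     (\<forall>x. x \<noteq> 0 \<longrightarrow> (\<exists>u. grad W x \<bullet> F x u < 0))"

definition small_control_property ::
    "(real^'n \<Rightarrow> real^'m \<Rightarrow> real^'n) \<Rightarrow> (real^'n \<Rightarrow> real) \<Rightarrow> bool" where
  "small_control_property F W \<longleftrightarrow>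
     (\<forall>\<epsilon>>0. \<exists>\<eta>>0. \<forall>x. 0 < norm x \<and> norm x < \<eta> \<longrightarrow>
        (\<exists>u. norm u < \<epsilon> \<and> grad W x \<bullet> F x u < 0))"

(* Admissible pairs (delta, Omega). The integral of a non-integrable function is 0 by convention,
   so the integrability that the formula for V_sharp presupposes is stated explicitly. *)
definition admissible :: "(real \<Rightarrow> real) \<Rightarrow> (real \<Rightarrow> real) \<Rightarrow> bool" where
  "admissible \<delta> \<Omega> \<longleftrightarrow>
     smooth_on {0..} \<delta> \<and> positive_definite_halfline \<delta> \<and>
     (\<forall>s\<ge>0. \<Omega> s \<ge> 0) \<and> (\<forall>a\<ge>0. \<Omega> integrable_on {0..a})"

definition V_sharp ::
    "(real^'n \<Rightarrow> real) \<Rightarrow> (real^'n \<Rightarrow> real^'n) \<Rightarrow> (real \<Rightarrow> real) \<Rightarrow> (real \<Rightarrow> real) \<Rightarrow> real^'n \<Rightarrow> real"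
  where
  "V_sharp V G \<delta> \<Omega> x = V x + integral {0..V x} \<Omega> + \<delta> (V x) * lie G V x"

end

theory Submission
  imports Defs "HOL-Computational_Algebra.Polynomial"
begin

text \<open>
  Let \<open>\<Omega> = 0\<close> and \<open>u(x) = -\<xi>(V(x)) L\<^sub>gV(x)\<close>. Since \<open>F\<close> is twice differentiable in the control, a small
  enough \<open>\<xi>\<close> makes \<open>N(x) = -\<nabla>V(x) F(x, u(x))\<close> at least \<open>-L\<^sub>fV + \<xi>/2 |L\<^sub>gV|\<^sup>2 \<ge> 0\<close>. Where \<open>N\<close> vanishes
  away from the origin, \<open>L\<^sub>fV = 0\<close> and \<open>L\<^sub>gV = 0\<close>, so \<open>u = 0\<close> and \<open>q(x) = \<nabla>(L\<^sub>GV)(x) F(x, u(x))\<close> equals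
  \<open>L\<^sub>fL\<^sub>GV < 0\<close>. By compactness, \<open>c q < N/2\<close> on the annulus \<open>\<alpha> \<le> V \<le> \<beta>\<close> for some \<open>c > 0\<close>. The derivative of
  \<open>V\<^sup>\<sharp>\<close> along the closed loop is \<open>-(1 + \<delta>'(V) L\<^sub>GV) N + \<delta>(V) q\<close>, hence negative as soon as \<open>\<delta>\<close> and
  \<open>|\<delta>'|\<close> are small enough on each level set. Such a smooth \<open>\<delta>\<close>, flat at \<open>0\<close>, is a series of bump
  functions with rapidly decreasing weights.
\<close>

subsection \<open>A smooth minorant\<close>

text \<open>On the real line the derivative in direction \<open>v\<close> is \<open>v\<close> times
  the ordinary one, so the induction treats all multiples \<open>v * D j\<close> together. This
  family is closed under differentiation.\<close>

lemma smooth_on_jet: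
  fixes D :: "nat \<Rightarrow> real \<Rightarrow> real"
  assumes "\<And>k x. (D k has_real_derivative D (Suc k) x) (at x)"
  shows "smooth_on S (D 0)"
proof -
  have "Ck_on k S (\<lambda>x. v * D j x)" for k j v
  proof (induction k arbitrary: j v)
    case 0
    show ?case
      using assms by (auto intro!: continuous_intros continuous_at_imp_continuous_on intro: DERIV_isCont)
  next
    case (Suc k)
    have "((\<lambda>x. v * D j x) has_derivative (\<lambda>h. (v * D (Suc j) x) * h)) (at x within S)" for x
      using DERIV_cmult[OF assms, of v j x]
      by (simp add: has_field_derivative_def has_derivative_at_withinI)
    moreover have "Ck_on k S (\<lambda>x. v * D (Suc j) x * h)" for h
      using Suc.IH[of "v * h" "Suc j"] by (simp add: mult.assoc mult.commute[of _ h] mult.left_commute[of _ h])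
    ultimately show ?case
      by (auto intro!: exI[of _ "\<lambda>x h. v * D (Suc j) x * h"])
  qed
  from this[of _ 1 0] show ?thesis by (simp add: smooth_on_def)
qed

lemma power_div_fact_le_exp:
  fixes x :: real
  assumes "0 \<le> x"
  shows "x ^ n / fact n \<le> exp x"
proof -
  have "(\<Sum>k\<in>{n}. inverse (fact k) *\<^sub>R x ^ k) \<le> (\<Sum>k. inverse (fact k) *\<^sub>R x ^ k)"
    by (rule sum_le_suminf) (use assms summable_exp_generic[of x] in auto)
  then show ?thesis by (simp add: exp_def field_simps)
qed

section \<open>Bump functions on an interval, with explicit derivatives of all orders\<close>

context
  fixes a b :: real
begin

definition bump_base :: "real poly" where
  "bump_base = [:-a, 1:] * [:b, -1:]"

text \<open>With w = (x - a)(b - x), the functions P exp(-1/w) / w^n extended by zero form a class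
  closed under differentiation. Recording only the numerator and the exponent gives every derivative
  of exp(-1/w) in closed form.\<close>

definition flat_fun :: "real poly \<Rightarrow> nat \<Rightarrow> real \<Rightarrow> real" where
  "flat_fun P n x = (if 0 < poly bump_base x
     then poly P x * exp (- 1 / poly bump_base x) / poly bump_base x ^ n else 0)"

text \<open>Numerator of the derivative of P exp(-1/w) / w^n over the common denominator w^(n+2).
  The three terms come from P, from w^(-n) and from the exponential.\<close>

definition flat_step :: "real poly \<Rightarrow> nat \<Rightarrow> real poly" where
  "flat_step P n = pderiv P * bump_base ^ 2 - smult (of_nat n) (P * pderiv bump_base * bump_base)
     + P * pderiv bump_base"

text \<open>The term of index n + 2 in the series of exp(1/w) gives exp(-1/w) / w^n \<le> (n+2)!
  w^2. The surviving square makes difference quotients tend to 0 at points where w is not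
  positive.\<close>

lemma flat_fun_abs_le: "\<bar>flat_fun P n x\<bar> \<le> \<bar>poly P x\<bar> * fact (n + 2) * (max 0 (poly bump_base x))\<^sup>2"
proof (cases "0 < poly bump_base x")
  case True
  define w where "w = poly bump_base x"
  have w: "0 < w" using True by (simp add: w_def)
  have "(1 / w) ^ (n + 2) / fact (n + 2) \<le> exp (1 / w)"
    using w by (intro power_div_fact_le_exp) auto
  then have "exp (- (1 / w)) / w ^ n \<le> fact (n + 2) * w\<^sup>2"
    using w by (simp add: exp_minus field_simps power_add power2_eq_square del: fact_Suc)
  then have "\<bar>poly P x\<bar> * (exp (- (1 / w)) / w ^ n) \<le> \<bar>poly P x\<bar> * (fact (n + 2) * w\<^sup>2)"
    by (rule mult_left_mono) auto
  then show ?thesis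
    using w by (simp add: flat_fun_def abs_mult mult.assoc flip: w_def del: fact_Suc)
qed (simp add: flat_fun_def)

lemma flat_fun_deriv: "(flat_fun P n has_real_derivative flat_fun (flat_step P n) (n + 2) x) (at x)"
proof (cases "0 < poly bump_base x")
  case True
  define w where "w = poly bump_base x"
  have w: "0 < w" using True by (simp add: w_def)
  define e where "e = exp (- 1 / w)"
  have e: "exp (- (1 / w)) = e" by (simp add: e_def)
  have "((\<lambda>x. poly P x * exp (- 1 / poly bump_base x)) has_real_derivative
      poly (pderiv P) x * e + poly P x * (e * (poly (pderiv bump_base) x / w\<^sup>2))) (at x)"
    using w unfolding e_def w_def
    by (auto intro!: derivative_eq_intros poly_DERIV simp: power2_eq_square)
  moreover have "((\<lambda>x. inverse (poly bump_base x ^ n)) has_real_derivative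
      - (of_nat n * poly (pderiv bump_base) x / w ^ Suc n)) (at x)"
  proof (cases n)
    case (Suc k)
    have "((\<lambda>x. inverse (poly bump_base x ^ Suc k)) has_real_derivative
        - (inverse (w ^ Suc k) * ((1 + of_nat k) * (poly (pderiv bump_base) x * w ^ k))
          * inverse (w ^ Suc k))) (at x)"
      using w unfolding w_def by (intro DERIV_inverse' DERIV_power_Suc poly_DERIV) simp
    moreover have "- (inverse (w ^ Suc k) * ((1 + of_nat k) * (poly (pderiv bump_base) x * w ^ k))
        * inverse (w ^ Suc k)) = - (of_nat n * poly (pderiv bump_base) x / w ^ Suc n)"
      using w by (simp add: Suc divide_simps)
    ultimately show ?thesis by (simp add: Suc)
  qed simp
  ultimately have "((\<lambda>x. poly P x * exp (- 1 / poly bump_base x) * inverse (poly bump_base x ^ n))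
      has_real_derivative (poly (pderiv P) x * e + poly P x * (e * (poly (pderiv bump_base) x / w\<^sup>2)))
        * inverse (w ^ n)
      + - (of_nat n * poly (pderiv bump_base) x / w ^ Suc n) * (poly P x * e)) (at x)"
    unfolding e_def w_def by (rule DERIV_mult)
  moreover have "(poly (pderiv P) x * e + poly P x * (e * (poly (pderiv bump_base) x / w\<^sup>2)))
        * inverse (w ^ n)
      + - (of_nat n * poly (pderiv bump_base) x / w ^ Suc n) * (poly P x * e)
      = flat_fun (flat_step P n) (n + 2) x"
    using w True by (simp add: flat_fun_def flat_step_def field_simps power2_eq_square e flip: w_def)
  ultimately have "((\<lambda>x. poly P x * exp (- 1 / poly bump_base x) / poly bump_base x ^ n)
      has_real_derivative flat_fun (flat_step P n) (n + 2) x) (at x)"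
    by (simp add: field_class.field_divide_inverse)
  moreover have "open {y. 0 < poly bump_base y}"
    by (intro open_Collect_less continuous_intros)
  from eventually_nhds_in_open[OF this] have "eventually (\<lambda>y. 0 < poly bump_base y) (nhds x)"
    using True by simp
  then have "eventually (\<lambda>y. flat_fun P n y =
      poly P y * exp (- 1 / poly bump_base y) / poly bump_base y ^ n) (nhds x)"
    by eventually_elim (simp add: flat_fun_def)
  ultimately show ?thesis
    by (subst DERIV_cong_ev[OF refl _ refl]) auto
next
  case False
  have "((\<lambda>y. (flat_fun P n y - flat_fun P n x) / (y - x)) \<longlongrightarrow> 0) (at x)"
  proof (rule Lim_null_comparison)
    let ?g = "\<lambda>y. \<bar>poly P y\<bar> * fact (n + 2) * (\<bar>y - x\<bar> * (a + b - x - y)\<^sup>2)"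
    have "norm ((flat_fun P n y - flat_fun P n x) / (y - x)) \<le> ?g y" if "y \<noteq> x" for y
    proof -
      \<comment> \<open>Since w(x) \<le> 0, the positive part of w(y) is at most |w(y) - w(x)|,
        which has the factor |y - x|. Its square beats the division by |y - x|.\<close>
      have "poly bump_base y - poly bump_base x = (y - x) * (a + b - x - y)"
        by (simp add: bump_base_def algebra_simps)
      then have "max 0 (poly bump_base y) \<le> \<bar>(y - x) * (a + b - x - y)\<bar>"
        using False by linarith
      then have "(max 0 (poly bump_base y))\<^sup>2 \<le> ((y - x) * (a + b - x - y))\<^sup>2"
        by (simp add: abs_le_square_iff[symmetric])
      then have "\<bar>flat_fun P n y\<bar> \<le> \<bar>poly P y\<bar> * fact (n + 2) * ((y - x) * (a + b - x - y))\<^sup>2"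
        using flat_fun_abs_le[of P n y] by (meson abs_ge_zero fact_ge_zero mult_left_mono mult_nonneg_nonneg order_trans)
      then have "\<bar>flat_fun P n y\<bar> / \<bar>y - x\<bar>
          \<le> \<bar>poly P y\<bar> * fact (n + 2) * ((y - x) * (a + b - x - y))\<^sup>2 / \<bar>y - x\<bar>"
        by (rule divide_right_mono) auto
      also have "\<dots> = ?g y"
      proof -
        have "((y - x) * (a + b - x - y))\<^sup>2 = \<bar>y - x\<bar> * (\<bar>y - x\<bar> * (a + b - x - y)\<^sup>2)"
          by (simp add: power_mult_distrib power2_eq_square flip: mult.assoc)
        then show ?thesis using that by (simp del: fact_Suc)
      qed
      finally show ?thesis using False by (simp add: flat_fun_def abs_divide del: fact_Suc)
    qed
    then show "\<forall>\<^sub>F y in at x. norm ((flat_fun P n y - flat_fun P n x) / (y - x)) \<le> ?g y"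
      by (auto simp: eventually_at_filter)
    have "(?g \<longlongrightarrow> \<bar>poly P x\<bar> * fact (n + 2) * (\<bar>x - x\<bar> * (a + b - x - x)\<^sup>2)) (at x)"
      by (intro tendsto_intros)
    then show "(?g \<longlongrightarrow> 0) (at x)" by simp
  qed
  then show ?thesis
    using False by (simp add: has_field_derivative_iff flat_fun_def)
qed

primrec bump_poly :: "nat \<Rightarrow> real poly" where
  "bump_poly 0 = 1"
| "bump_poly (Suc k) = flat_step (bump_poly k) (2 * k)"

text \<open>The k-th derivative of exp(-1/w) extended by zero. Each differentiation raises the
  exponent of the denominator by 2, whence \<open>2 * k\<close>.\<close>

definition bump_jet :: "nat \<Rightarrow> real \<Rightarrow> real" where
  "bump_jet k = flat_fun (bump_poly k) (2 * k)"

lemma bump_jet_deriv: "(bump_jet k has_real_derivative bump_jet (Suc k) x) (at x)"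
  using flat_fun_deriv[of "bump_poly k" "2 * k" x] by (simp add: bump_jet_def)

lemma poly_bump_base: "poly bump_base x = (x - a) * (b - x)"
  by (simp add: bump_base_def algebra_simps)

lemma bump_base_pos_iff: "a < b \<Longrightarrow> 0 < poly bump_base x \<longleftrightarrow> x \<in> {a<..<b}"
  by (auto simp: poly_bump_base zero_less_mult_iff)

lemma bump_jet_outside: "a < b \<Longrightarrow> x \<notin> {a<..<b} \<Longrightarrow> bump_jet k x = 0"
  by (simp add: bump_jet_def flat_fun_def bump_base_pos_iff del: greaterThanLessThan_iff)

lemma bump_jet_pos: "a < b \<Longrightarrow> x \<in> {a<..<b} \<Longrightarrow> 0 < bump_jet 0 x"
  by (simp add: bump_jet_def flat_fun_def bump_base_pos_iff del: greaterThanLessThan_iff)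

lemma bump_jet_bounded:
  assumes "a < b"
  shows "\<exists>B>0. \<forall>x. \<bar>bump_jet k x\<bar> \<le> B"
proof -
  have "compact (bump_jet k ` {a..b})"
    by (intro compact_continuous_image continuous_at_imp_continuous_on ballI)
      (auto intro: DERIV_isCont bump_jet_deriv)
  then obtain B where "0 < B" "\<And>x. x \<in> {a..b} \<Longrightarrow> \<bar>bump_jet k x\<bar> \<le> B"
    using bounded_pos[of "bump_jet k ` {a..b}"] compact_imp_bounded by (auto simp: image_iff)
  moreover have "\<bar>bump_jet k x\<bar> \<le> B" if "x \<notin> {a..b}" for x
    using bump_jet_outside[of x k] that assms \<open>0 < B\<close> by auto
  ultimately show ?thesis by blast
qed

end

text \<open>Read \<open>B s c\<close> as: c is a permitted bound at level s. Permitted bounds are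
  uniform only on compact parts of the open half-line, so the function is a series of bumps on the
  nested intervals from 1/(k+2) to k+2, each weighted by the bounds found on the intervals up to its
  own.\<close>

lemma smooth_minorant:
  fixes B :: "real \<Rightarrow> real \<Rightarrow> bool"
  assumes B: "\<And>a b. 0 < a \<Longrightarrow> \<exists>c>0. \<forall>s\<in>{a..b}. B s c"
  obtains D :: "nat \<Rightarrow> real \<Rightarrow> real"
  where "\<And>k x. (D k has_real_derivative D (Suc k) x) (at x)"
    and "\<And>s. s \<le> 0 \<Longrightarrow> D 0 s = 0"
    and "\<And>s. 0 < s \<Longrightarrow> 0 < D 0 s"
    and "\<And>s. 0 < s \<Longrightarrow> \<exists>c. B s c \<and> D 0 s \<le> c \<and> \<bar>D 1 s\<bar> \<le> c"
proof -
  define l where "l k = 1 / (real k + 2)" for k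
  define r where "r k = real k + 2" for k
  have l_pos: "0 < l k" for k by (simp add: l_def)
  have lr: "l k < r k" for k
    by (simp add: l_def r_def field_simps) (smt (verit) mult_nonneg_nonneg of_nat_0_le_iff)
  have "\<forall>k. \<exists>c>0. \<forall>s\<in>{l k..r k}. B s c"
    using B[OF l_pos] by blast
  then obtain c where c_pos: "\<And>k. 0 < c k" and c: "\<And>k s. s \<in> {l k..r k} \<Longrightarrow> B s (c k)"
    by metis
  define E where "E k = bump_jet (l k) (r k)" for k
  have "\<forall>k j. \<exists>M>0. \<forall>x. \<bar>E k j x\<bar> \<le> M"
    unfolding E_def using bump_jet_bounded[OF lr] by blast
  then obtain M where M_pos: "\<And>k j. 0 < M k j" and M: "\<And>k j x. \<bar>E k j x\<bar> \<le> M k j"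
    by metis
  \<comment> \<open>The minimum makes the k-th weight respect the bounds of all smaller intervals;
    the entry 1 bounds the weights for convergence.\<close>
  define m where "m k = Min (insert 1 (c ` {..k}))" for k
  \<comment> \<open>Dividing by this sum controls the derivatives of order at most k + 1 of the k-th
    bump. For a fixed order that covers all but finitely many k, and orders 0 and 1 are covered for
    every k.\<close>
  define S where "S k = (\<Sum>j\<le>Suc k. M k j)" for k
  define w where "w k = (1/2) ^ Suc k * m k / S k" for k
  have m_pos: "0 < m k" for k
    using c_pos by (auto simp: m_def)
  have m_le_1: "m k \<le> 1" for k
    unfolding m_def by (rule Min_le) auto
  have m_le: "m k \<le> c i" if "i \<le> k" for i k
    unfolding m_def using that by (intro Min_le) auto
  have S_pos: "0 < S k" for k
    unfolding S_def by (intro sum_pos) (auto simp: M_pos)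
  have w_pos: "0 < w k" for k
    unfolding w_def using m_pos S_pos by simp
  have term_le: "\<bar>w k * E k j x\<bar> \<le> (1/2) ^ Suc k * m k" if "j \<le> Suc k" for k j x
  proof -
    have "\<bar>E k j x\<bar> \<le> M k j" by (rule M)
    also have "M k j \<le> S k"
      unfolding S_def using that by (intro member_le_sum) (auto intro: less_imp_le M_pos)
    finally have "\<bar>w k * E k j x\<bar> \<le> w k * S k"
      using w_pos[of k] by (simp add: abs_mult)
    then show ?thesis using S_pos[of k] by (simp add: w_def)
  qed
  have geo: "(\<lambda>k. (1/2::real) ^ Suc k) sums 1"
    by (rule power_half_series)
  have sm: "summable (\<lambda>k. (1/2::real) ^ Suc k)"
    using geo by (rule sums_summable)
  define D where "D j x = (\<Sum>k. w k * E k j x)" for j x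
  have summ: "summable (\<lambda>k. w k * E k j x)" for j x
  proof (rule summable_comparison_test'[OF sm])
    fix k assume "j \<le> k"
    then have "\<bar>w k * E k j x\<bar> \<le> (1/2) ^ Suc k * m k" by (intro term_le) auto
    also have "\<dots> \<le> (1/2) ^ Suc k * 1" by (intro mult_left_mono m_le_1) auto
    finally show "norm (w k * E k j x) \<le> (1/2) ^ Suc k" by simp
  qed
  have deriv: "(D j has_real_derivative D (Suc j) x) (at x)" for j x
  proof -
    \<comment> \<open>Termwise differentiation needs uniform convergence of the differentiated
      series; the geometric majorant holds from index j on.\<close>
    have "uniform_limit UNIV (\<lambda>n x. \<Sum>k<n. w k * E k (Suc j) x) (\<lambda>x. \<Sum>k. w k * E k (Suc j) x) sequentially"
    proof (rule Weierstrass_m_test_ev[OF _ sm])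
      show "\<forall>\<^sub>F k in sequentially. \<forall>x\<in>UNIV. norm (w k * E k (Suc j) x) \<le> (1/2) ^ Suc k"
      proof (rule eventually_sequentiallyI[of j], intro ballI)
        fix k x assume "j \<le> k"
        then have "\<bar>w k * E k (Suc j) x\<bar> \<le> (1/2) ^ Suc k * m k" by (intro term_le) auto
        also have "\<dots> \<le> (1/2) ^ Suc k * 1" by (intro mult_left_mono m_le_1) auto
        finally show "norm (w k * E k (Suc j) x) \<le> (1/2) ^ Suc k" by simp
      qed
    qed
    then have "uniformly_convergent_on UNIV (\<lambda>n x. \<Sum>k<n. w k * E k (Suc j) x)"
      by (auto simp: uniformly_convergent_on_def)
    then show ?thesis
      unfolding D_def
      using summ by (intro has_field_derivative_series'(2)
          [where S = UNIV and f = "\<lambda>k x. w k * E k j x" and f' = "\<lambda>k x. w k * E k (Suc j) x"])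
        (auto simp: E_def intro!: DERIV_cmult bump_jet_deriv)
  qed
  have E_out: "E k j s = 0" if "s \<notin> {l k<..<r k}" for k j s
    using bump_jet_outside[OF lr that] by (simp add: E_def)
  have E_pos: "0 < E k 0 s" if "s \<in> {l k<..<r k}" for k s
    using bump_jet_pos[OF lr that] by (simp add: E_def)
  have zero: "D 0 s = 0" if "s \<le> 0" for s
  proof -
    have "E k 0 s = 0" for k using that l_pos[of k] by (intro E_out) auto
    then show ?thesis by (simp add: D_def)
  qed
  have ex_k: "\<exists>k. s \<in> {l k<..<r k}" if "0 < s" for s
  proof -
    obtain k :: nat where "s + 1 / s < k" using reals_Archimedean2 by blast
    moreover have "0 < 1 / s" using that by simp
    ultimately have "1 / s < real k + 2" "s < real k + 2" using that by linarith+
    then have "s \<in> {l k<..<r k}" using that by (simp add: l_def r_def field_simps)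
    then show ?thesis ..
  qed
  have pos: "0 < D 0 s" if "0 < s" for s
  proof -
    have E_nonneg: "0 \<le> E k 0 s" for k using E_out E_pos less_imp_le order_refl by metis
    obtain k where "s \<in> {l k<..<r k}" using ex_k[OF \<open>0 < s\<close>] by blast
    then have "0 < w k * E k 0 s" using w_pos E_pos by simp
    then show ?thesis
      unfolding D_def using E_nonneg w_pos
      by (intro suminf_pos2[OF summ, of _ _ k]) (auto simp: less_imp_le)
  qed
  have bound: "\<exists>i. B s i \<and> D 0 s \<le> i \<and> \<bar>D 1 s\<bar> \<le> i" if "0 < s" for s
  proof -
    \<comment> \<open>Bumps before the first interval containing s vanish at s, and every later
      weight carries a factor at most \<open>c K\<close>. The geometric series sums to 1, so
      \<open>D 0\<close> and \<open>D 1\<close> are bounded by \<open>c K\<close> at s.\<close>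
    define K where "K = (LEAST k. s \<in> {l k<..<r k})"
    have K: "s \<in> {l K<..<r K}" unfolding K_def using ex_k[OF that] by (rule LeastI_ex)
    have le: "\<bar>D j s\<bar> \<le> c K" if "j \<le> 1" for j
    proof -
      have *: "norm (w k * E k j s) \<le> (1/2) ^ Suc k * c K" for k
      proof (cases "k < K")
        case True
        then have "E k j s = 0" using not_less_Least K_def by (intro E_out) blast
        then show ?thesis using c_pos[of K] by simp
      next
        case False
        then have "(1/2) ^ Suc k * m k \<le> (1/2) ^ Suc k * c K"
          by (intro mult_left_mono m_le) auto
        moreover have "\<bar>w k * E k j s\<bar> \<le> (1/2) ^ Suc k * m k"
          using that by (intro term_le) simp
        ultimately show ?thesis by (metis order_trans real_norm_def)
      qed
      have "norm (D j s) \<le> (\<Sum>k. (1/2) ^ Suc k * c K)"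
        unfolding D_def by (rule norm_suminf_le[OF *]) (intro summable_mult2 sm)
      also have "\<dots> = c K"
        using sums_mult2[OF geo, of "c K"] by (simp add: sums_iff)
      finally show ?thesis by simp
    qed
    have "B s (c K)" using K by (intro c) auto
    then show ?thesis using le[of 0] le[of 1] by (intro exI[of _ "c K"]) auto
  qed
  show thesis using that[OF deriv zero pos bound] .
qed

subsection \<open>Second-order expansion in the control\<close>

text \<open>Fixing x and composing with u \<mapsto> (x, u) expresses the Jacobian in the control
  through the joint derivative.\<close>

lemma input_matrix_mult:
  fixes F :: "real^'n \<Rightarrow> real^'m \<Rightarrow> real^'n"
  assumes "((\<lambda>(x, u). F x u) has_derivative F') (at (x, 0))"
  shows "input_matrix F x *v u = F' (0, u)"
proof -
  have "((\<lambda>u. (\<lambda>(x, u). F x u) (x, u)) has_derivative (\<lambda>u. F' (0, u))) (at 0)"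
    by (rule has_derivative_compose[of "\<lambda>u. (x, u)", OF _ assms])
      (auto intro!: derivative_eq_intros)
  then have *: "(F x has_derivative (\<lambda>u. F' (0, u))) (at 0)" by simp
  then have "(F x has_derivative (\<lambda>h. input_matrix F x *v h)) (at 0)"
    unfolding input_matrix_def using jacobian_works differentiableI by blast
  from has_derivative_unique[OF * this] show ?thesis by metis
qed

text \<open>Only bounds on partial derivatives are given, so u is reached from 0 by switching on one
  coordinate at a time, with the mean value inequality on each segment. The path stays in the ball
  because its coordinates never exceed those of u in absolute value.\<close>

lemma partials_lipschitz:
  fixes p :: "real^'m \<Rightarrow> real"
  assumes deriv: "\<And>k u. ((\<lambda>t. p (u + t *\<^sub>R axis k 1)) has_real_derivative q k u) (at 0)"
    and bound: "\<And>k u. norm u \<le> r \<Longrightarrow> \<bar>q k u\<bar> \<le> M"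
    and u: "norm u \<le> r"
  shows "\<bar>p u - p 0\<bar> \<le> M * (\<Sum>k\<in>UNIV. \<bar>u $ k\<bar>)"
proof -
  define tr where "tr A = (\<chi> k. if k \<in> A then u $ k else 0)" for A :: "'m set"
  have "\<bar>p (tr A) - p 0\<bar> \<le> M * (\<Sum>k\<in>A. \<bar>u $ k\<bar>)" if "finite A" for A
    using that
  proof induction
    case empty
    have "tr {} = 0" by (simp add: tr_def vec_eq_iff)
    then show ?case by simp
  next
    case (insert k A)
    have step: "tr (insert k A) = tr A + (u $ k) *\<^sub>R axis k 1"
      using insert by (auto simp: tr_def vec_eq_iff axis_def)
    have small: "norm (tr A + s *\<^sub>R axis k 1) \<le> r" if "\<bar>s\<bar> \<le> \<bar>u $ k\<bar>" for s
    proof -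
      have "norm (tr A + s *\<^sub>R axis k 1) \<le> norm u"
        using that insert by (intro norm_le_componentwise_cart) (auto simp: tr_def axis_def)
      then show ?thesis using u by simp
    qed
    \<comment> \<open>The hypothesis differentiates only at t = 0; moving the base point along the
      axis gives the derivative at every s.\<close>
    have D: "((\<lambda>t. p (tr A + t *\<^sub>R axis k 1)) has_real_derivative q k (tr A + s *\<^sub>R axis k 1)) (at s)" for s
    proof -
      have "((\<lambda>t. p (tr A + s *\<^sub>R axis k 1 + t *\<^sub>R axis k 1)) has_real_derivative
          q k (tr A + s *\<^sub>R axis k 1)) (at (s + - s))"
        using deriv by simp
      then have "((\<lambda>t. p (tr A + s *\<^sub>R axis k 1 + (t + - s) *\<^sub>R axis k 1)) has_real_derivative
          q k (tr A + s *\<^sub>R axis k 1)) (at s)"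
        unfolding DERIV_shift .
      then show ?thesis by (simp add: algebra_simps)
    qed
    have "norm (p (tr A + (u $ k) *\<^sub>R axis k 1) - p (tr A + 0 *\<^sub>R axis k 1)) \<le> M * norm (u $ k - 0)"
    proof (rule field_differentiable_bound[where S = "{- \<bar>u $ k\<bar>..\<bar>u $ k\<bar>}"])
      show "((\<lambda>t. p (tr A + t *\<^sub>R axis k 1)) has_real_derivative q k (tr A + s *\<^sub>R axis k 1))
          (at s within {- \<bar>u $ k\<bar>..\<bar>u $ k\<bar>})" for s
        using D by (rule has_field_derivative_at_within)
      show "norm (q k (tr A + s *\<^sub>R axis k 1)) \<le> M" if "s \<in> {- \<bar>u $ k\<bar>..\<bar>u $ k\<bar>}" for s
        using that by (auto intro!: bound small)
    qed auto
    then have "\<bar>p (tr (insert k A)) - p (tr A)\<bar> \<le> M * \<bar>u $ k\<bar>"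
      by (simp add: step)
    moreover have "M * (\<Sum>i\<in>insert k A. \<bar>u $ i\<bar>) = M * \<bar>u $ k\<bar> + M * (\<Sum>i\<in>A. \<bar>u $ i\<bar>)"
      using insert by (simp add: distrib_left)
    ultimately show ?case using insert.IH by linarith
  qed
  from this[of UNIV] show ?thesis by (simp add: tr_def vec_lambda_eta)
qed

text \<open>Componentwise, the mean value theorem along t \<mapsto> t u turns the increment of F
  into the control derivative at an intermediate point. Its entries differ from those at u = 0 by
  O(|u|), uniformly on K, because the second partials are bounded on K times the unit ball.\<close>

lemma control_remainder:
  fixes F :: "real^'n \<Rightarrow> real^'m \<Rightarrow> real^'n"
  assumes F': "\<And>z. ((\<lambda>(x, u). F x u) has_derivative F' z) (at z)"
    and C2: "C2_in_control F"
    and K: "compact K"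
  shows "\<exists>C\<ge>0. \<forall>x\<in>K. \<forall>u. norm u \<le> 1 \<longrightarrow>
    norm (F x u - F x 0 - input_matrix F x *v u) \<le> C * (norm u)\<^sup>2"
proof -
  obtain P Q where
    P: "\<And>i j x u. ((\<lambda>t. F x (u + t *\<^sub>R axis j 1) $ i) has_real_derivative P i j x u) (at 0)" and
    Q: "\<And>i j k x u. ((\<lambda>t. P i j x (u + t *\<^sub>R axis k 1)) has_real_derivative Q i j k x u) (at 0)" and
    contQ: "\<And>i j k. continuous_on UNIV (\<lambda>(x, u). Q i j k x u)"
    using C2 unfolding C2_in_control_def by blast
  have "\<exists>M. \<forall>x\<in>K. \<forall>u. norm u \<le> 1 \<longrightarrow> \<bar>Q i j k x u\<bar> \<le> M" for i j k
  proof -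
    have "compact ((\<lambda>(x, u). Q i j k x u) ` (K \<times> cball 0 1))"
      using K contQ by (intro compact_continuous_image compact_Times)
        (auto intro: continuous_on_subset)
    then obtain M where "\<And>z. z \<in> (\<lambda>(x, u). Q i j k x u) ` (K \<times> cball 0 1) \<Longrightarrow> norm z \<le> M"
      using compact_imp_bounded bounded_iff by metis
    then show ?thesis by (intro exI[of _ M]) force
  qed
  then obtain m where m: "\<And>i j k x u. x \<in> K \<Longrightarrow> norm u \<le> 1 \<Longrightarrow> \<bar>Q i j k x u\<bar> \<le> m i j k"
    by metis
  define M where "M = (\<Sum>i\<in>UNIV. \<Sum>j\<in>UNIV. \<Sum>k\<in>UNIV. \<bar>m i j k\<bar>)"
  have M: "\<bar>Q i j k x u\<bar> \<le> M" if "x \<in> K" "norm u \<le> 1" for i j k x u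
  proof -
    have "\<bar>m i j k\<bar> \<le> (\<Sum>k\<in>UNIV. \<bar>m i j k\<bar>)" by (rule member_le_sum) auto
    also have "\<dots> \<le> (\<Sum>j\<in>UNIV. \<Sum>k\<in>UNIV. \<bar>m i j k\<bar>)"
      by (rule member_le_sum[of j UNIV "\<lambda>j. \<Sum>k\<in>UNIV. \<bar>m i j k\<bar>"]) (auto intro: sum_nonneg)
    also have "\<dots> \<le> M"
      unfolding M_def
      by (rule member_le_sum[of i UNIV "\<lambda>i. \<Sum>j\<in>UNIV. \<Sum>k\<in>UNIV. \<bar>m i j k\<bar>"]) (auto intro!: sum_nonneg)
    finally show ?thesis using m[OF that, of i j k] by linarith
  qed
  have M_nonneg: "0 \<le> M" unfolding M_def by (intro sum_nonneg) auto
  \<comment> \<open>The partial derivatives supplied by \<open>C2_in_control\<close> are identified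
    with the entries of the joint derivative.\<close>
  have P_eq: "F' (x, u) (0, v) $ i = (\<Sum>j\<in>UNIV. P i j x u * v $ j)" for x u v i
  proof -
    have lin: "bounded_linear (F' (x, u))" using F' by (rule has_derivative_bounded_linear)
    have "F' (x, u) (0, axis j 1) $ i = P i j x u" for j
    proof -
      have "((\<lambda>t. (\<lambda>(x, u). F x u) (x, u + t *\<^sub>R axis j 1)) has_derivative
          (\<lambda>t. F' (x, u) (0, t *\<^sub>R axis j 1))) (at 0)"
        by (rule has_derivative_compose[of "\<lambda>t. (x, u + t *\<^sub>R axis j 1)" "\<lambda>t. (0, t *\<^sub>R axis j 1)"])
          (use F'[of "(x, u)"] in \<open>auto intro!: derivative_eq_intros\<close>)
      then have "((\<lambda>t. F x (u + t *\<^sub>R axis j 1) $ i) has_derivative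
          (\<lambda>t. F' (x, u) (0, t *\<^sub>R axis j 1) $ i)) (at 0)"
        by (auto intro: bounded_linear.has_derivative[OF bounded_linear_vec_nth])
      from has_derivative_unique[OF this P[unfolded has_field_derivative_def]]
      have "F' (x, u) (0, 1 *\<^sub>R axis j 1) $ i = P i j x u * 1" by metis
      then show ?thesis by simp
    qed
    moreover have "F' (x, u) (0, v) = (\<Sum>j\<in>UNIV. v $ j *\<^sub>R F' (x, u) (0, axis j 1))"
    proof -
      interpret bounded_linear "F' (x, u)" by (rule lin)
      have "(0, v) = (\<Sum>j\<in>UNIV. v $ j *\<^sub>R (0 :: real^'n, axis j 1 :: real^'m))"
        using basis_expansion[of v] by (simp add: prod_eq_iff fst_sum snd_sum scalar_mult_eq_scaleR)
      then have "F' (x, u) (0, v) = F' (x, u) (\<Sum>j\<in>UNIV. v $ j *\<^sub>R (0, axis j 1))" by (rule arg_cong)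
      then show ?thesis by (simp only: sum scaleR)
    qed
    ultimately show ?thesis by (simp add: sum_component mult.commute)
  qed
  \<comment> \<open>One factor m comes from the l1 norm in the Lipschitz estimate, the other from
    the sum over j, and n from the l1 norm over the components of F.\<close>
  define n m where "n = real CARD('n)" and "m = real CARD('m)"
  have "norm (F x u - F x 0 - input_matrix F x *v u) \<le> n * m * m * M * (norm u)\<^sup>2"
    if x: "x \<in> K" and u: "norm u \<le> 1" for x u
  proof -
    have "\<bar>(F x u - F x 0 - input_matrix F x *v u) $ i\<bar> \<le> m * (m * M * (norm u)\<^sup>2)" for i
    proof -
      have "((\<lambda>t. F x (t *\<^sub>R u) $ i) has_derivative (\<lambda>h. F' (x, t *\<^sub>R u) (0, h *\<^sub>R u) $ i)) (at t)" for t
      proof -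
        have "((\<lambda>t. (\<lambda>(x, u). F x u) (x, t *\<^sub>R u)) has_derivative
            (\<lambda>h. F' (x, t *\<^sub>R u) (0, h *\<^sub>R u))) (at t)"
          by (rule has_derivative_compose[of "\<lambda>t. (x, t *\<^sub>R u)" "\<lambda>t. (0, t *\<^sub>R u)"])
            (use F'[of "(x, t *\<^sub>R u)"] in \<open>auto intro!: derivative_eq_intros\<close>)
        then show ?thesis by (auto intro: bounded_linear.has_derivative[OF bounded_linear_vec_nth])
      qed
      then have "((\<lambda>t. F x (t *\<^sub>R u) $ i) has_derivative (\<lambda>h. F' (x, t *\<^sub>R u) (0, h *\<^sub>R u) $ i))
          (at t within {0..1})" for t
        by (rule has_derivative_at_withinI)
      then obtain t where t: "t \<in> {0..1}"
        and eq: "F x (1 *\<^sub>R u) $ i - F x (0 *\<^sub>R u) $ i = F' (x, t *\<^sub>R u) (0, (1 - 0) *\<^sub>R u) $ i"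
        using mvt_very_simple[of 0 1 "\<lambda>t. F x (t *\<^sub>R u) $ i"
            "\<lambda>t h. F' (x, t *\<^sub>R u) (0, h *\<^sub>R u) $ i"]
        by auto
      have tu: "norm (t *\<^sub>R u) \<le> norm u" using t by (auto simp: mult_left_le_one_le)
      have "(F x u - F x 0 - input_matrix F x *v u) $ i
          = (\<Sum>j\<in>UNIV. P i j x (t *\<^sub>R u) * u $ j) - (\<Sum>j\<in>UNIV. P i j x 0 * u $ j)"
        using eq by (simp add: input_matrix_mult[OF F'] P_eq)
      also have "\<dots> = (\<Sum>j\<in>UNIV. (P i j x (t *\<^sub>R u) - P i j x 0) * u $ j)"
        by (simp add: left_diff_distrib sum_subtractf)
      also have "\<bar>\<dots>\<bar> \<le> (\<Sum>j\<in>(UNIV::'m set). m * M * (norm u)\<^sup>2)"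
      proof (rule order_trans[OF sum_abs sum_mono])
        fix j
        have "\<bar>P i j x (t *\<^sub>R u) - P i j x 0\<bar> \<le> M * (\<Sum>k\<in>UNIV. \<bar>(t *\<^sub>R u) $ k\<bar>)"
          using tu u by (intro partials_lipschitz[of _ "\<lambda>k u. Q i j k x u" 1] Q M x) auto
        also have "\<dots> \<le> M * (\<Sum>k\<in>(UNIV::'m set). norm u)"
          using tu component_le_norm_cart[of "t *\<^sub>R u"]
          by (intro mult_left_mono sum_mono M_nonneg) (meson order_trans)
        finally have "\<bar>P i j x (t *\<^sub>R u) - P i j x 0\<bar> \<le> m * M * norm u"
          by (simp add: m_def mult_ac)
        then have "\<bar>P i j x (t *\<^sub>R u) - P i j x 0\<bar> * \<bar>u $ j\<bar> \<le> (m * M * norm u) * norm u"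
          by (intro mult_mono component_le_norm_cart) (auto simp: m_def M_nonneg)
        then show "\<bar>(P i j x (t *\<^sub>R u) - P i j x 0) * u $ j\<bar> \<le> m * M * (norm u)\<^sup>2"
          by (simp add: abs_mult power2_eq_square mult_ac)
      qed
      finally show ?thesis by (simp add: m_def)
    qed
    then have "(\<Sum>i\<in>UNIV. \<bar>(F x u - F x 0 - input_matrix F x *v u) $ i\<bar>)
        \<le> (\<Sum>i\<in>(UNIV::'n set). m * (m * M * (norm u)\<^sup>2))"
      by (intro sum_mono)
    then show ?thesis
      using norm_le_l1_cart[of "F x u - F x 0 - input_matrix F x *v u"] by (simp add: n_def mult_ac)
  qed
  then show ?thesis
    using M_nonneg by (intro exI[of _ "n * m * m * M"]) (auto simp: n_def m_def)
qed

subsection \<open>The strict Lyapunov function\<close>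

lemma inner_grad:
  assumes "(f has_derivative f') (at x)"
  shows "grad f x \<bullet> w = f' w"
proof -
  have f': "frechet_derivative f (at x) = f'"
    using frechet_derivative_at[OF assms] by simp
  interpret bounded_linear f' using assms by (rule has_derivative_bounded_linear)
  have "f' w = f' (\<Sum>i\<in>UNIV. w $ i *\<^sub>R axis i 1)"
    using basis_expansion[of w] by (simp add: scalar_mult_eq_scaleR)
  also have "\<dots> = (\<Sum>i\<in>UNIV. w $ i * f' (axis i 1))"
    by (simp add: sum scaleR)
  finally show ?thesis
    by (simp add: grad_def f' inner_vec_def mult.commute)
qed

text \<open>Replaces the existential witness in \<open>Ck_on 1\<close> by the concrete gradient,
  whose components are the derivatives along the axes.\<close>

lemma C1_iff_grad:
  "Ck_on 1 UNIV f \<longleftrightarrow>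
    (\<forall>x. (f has_derivative (\<lambda>h. grad f x \<bullet> h)) (at x)) \<and> continuous_on UNIV (grad f)"
proof
  assume "Ck_on 1 UNIV f"
  then obtain f' where f': "\<And>x. (f has_derivative f' x) (at x)"
    and cont: "\<And>v. continuous_on UNIV (\<lambda>x. f' x v)"
    by auto
  have eq: "grad f x \<bullet> h = f' x h" for x h
    using f' by (rule inner_grad)
  have "grad f = (\<lambda>x. \<chi> i. f' x (axis i 1))"
    by (simp add: fun_eq_iff vec_eq_iff flip: eq) (simp add: inner_axis)
  then have "continuous_on UNIV (grad f)"
    using cont by (auto intro!: continuous_intros)
  then show "(\<forall>x. (f has_derivative (\<lambda>h. grad f x \<bullet> h)) (at x)) \<and> continuous_on UNIV (grad f)"
    using f' by (simp add: eq)
next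
  assume "(\<forall>x. (f has_derivative (\<lambda>h. grad f x \<bullet> h)) (at x)) \<and> continuous_on UNIV (grad f)"
  then show "Ck_on 1 UNIV f"
    by (auto intro!: exI[of _ "\<lambda>x h. grad f x \<bullet> h"] continuous_intros)
qed

text \<open>The product rule applied to the coordinate expansion of L_GV; it brings in second
  derivatives of V and first derivatives of G, all continuous.\<close>

lemma C1_lie:
  assumes "Ck_on 2 UNIV V" and "Ck_on 1 UNIV G"
  shows "Ck_on 1 UNIV (lie G V)"
proof -
  obtain V' where V': "\<And>x. (V has_derivative V' x) (at x)" and "\<And>v. Ck_on 1 UNIV (\<lambda>x. V' x v)"
    using assms(1) by (auto simp: numeral_2_eq_2)
  then have "\<forall>v. \<exists>H. (\<forall>x. ((\<lambda>x. V' x v) has_derivative H x) (at x)) \<and>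
      (\<forall>h. continuous_on UNIV (\<lambda>x. H x h))"
    by simp
  then obtain H where H: "\<And>v x. ((\<lambda>x. V' x v) has_derivative H v x) (at x)"
    and cont_H: "\<And>v h. continuous_on UNIV (\<lambda>x. H v x h)"
    by metis
  obtain G' where G': "\<And>x. (G has_derivative G' x) (at x)"
    and cont_G': "\<And>v. continuous_on UNIV (\<lambda>x. G' x v)"
    using assms(2) by auto
  have cont: "continuous_on UNIV G" "continuous_on UNIV (\<lambda>x. V' x v)" for v
    using G' H has_derivative_continuous by (blast intro: continuous_at_imp_continuous_on)+
  have lie_eq: "lie G V = (\<lambda>x. \<Sum>i\<in>UNIV. V' x (axis i 1) * G x $ i)"
  proof
    fix x
    have "grad V x $ i = V' x (axis i 1)" for i
      using inner_grad[OF V', of x "axis i 1"] by (simp add: inner_axis)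
    then show "lie G V x = (\<Sum>i\<in>UNIV. V' x (axis i 1) * G x $ i)"
      by (simp add: lie_def inner_vec_def)
  qed
  have "(lie G V has_derivative (\<lambda>h. \<Sum>i\<in>UNIV. V' x (axis i 1) * G' x h $ i + H (axis i 1) x h * G x $ i))
      (at x)" for x
    unfolding lie_eq
    by (intro has_derivative_sum has_derivative_mult H bounded_linear.has_derivative[OF bounded_linear_vec_nth] G')
  moreover have "continuous_on UNIV (\<lambda>x. \<Sum>i\<in>UNIV. V' x (axis i 1) * G' x h $ i + H (axis i 1) x h * G x $ i)" for h
    by (intro continuous_intros cont cont_H cont_G')
  ultimately show ?thesis
    by (auto intro!: exI[of _ "\<lambda>x h. \<Sum>i\<in>UNIV. V' x (axis i 1) * G' x h $ i + H (axis i 1) x h * G x $ i"])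
qed

section \<open>Compactness and uniform estimates on compact sets\<close>

lemma compact_sublevel:
  fixes V :: "'a::euclidean_space \<Rightarrow> real"
  assumes "continuous_on UNIV V" and "radially_unbounded V"
  shows "compact {x. V x \<le> b}"
proof -
  have "\<forall>\<^sub>F x in at_infinity. b < V x"
    using assms(2) by (simp add: radially_unbounded_def filterlim_at_top_dense)
  then obtain r where "\<And>x. r \<le> norm x \<Longrightarrow> b < V x"
    by (auto simp: eventually_at_infinity)
  then have "{x. V x \<le> b} \<subseteq> cball 0 r"
    by (force simp: not_less[symmetric])
  then have "bounded {x. V x \<le> b}"
    by (rule bounded_subset[OF bounded_cball])
  moreover have "closed {x. V x \<le> b}"
    using assms(1) by (intro closed_Collect_le) auto
  ultimately show ?thesis by (simp add: compact_eq_bounded_closed)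
qed

lemma compact_norm_bound:
  fixes f :: "'a::topological_space \<Rightarrow> 'b::real_normed_vector"
  assumes "compact K" and "continuous_on UNIV f"
  obtains M where "0 < M" and "\<And>x. x \<in> K \<Longrightarrow> norm (f x) \<le> M"
proof -
  have "bounded (f ` K)"
    using assms by (intro compact_imp_bounded compact_continuous_image) (auto intro: continuous_on_subset)
  then obtain M where "0 < M" "\<forall>y\<in>f ` K. norm y \<le> M"
    using bounded_pos[of "f ` K"] by auto
  then show thesis using that[of M] by auto
qed

lemma lie_mat_inner: "lie_mat g V x \<bullet> u = grad V x \<bullet> (g x *v u)"
  by (simp add: lie_mat_def dot_lmul_matrix)

text \<open>With a = L_gV and u = -t a, the linear term contributes -t |a|^2 while the remainder is
  of order t^2 |a|^2. For small t it costs at most half of the linear decrease.\<close>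

lemma damping_decrease:
  fixes F :: "real^'n \<Rightarrow> real^'m \<Rightarrow> real^'n"
  assumes F': "\<And>z. ((\<lambda>(x, u). F x u) has_derivative F' z) (at z)"
    and C2: "C2_in_control F"
    and K: "compact K"
    and grad_V: "continuous_on UNIV (grad V)"
    and cont_LgV: "continuous_on UNIV (lie_mat (input_matrix F) V)"
  shows "\<exists>c>0. \<forall>x\<in>K. \<forall>t\<in>{0..c}. grad V x \<bullet> F x (- t *\<^sub>R lie_mat (input_matrix F) V x)
    \<le> lie (drift F) V x - t / 2 * (norm (lie_mat (input_matrix F) V x))\<^sup>2"
proof -
  define a where "a = lie_mat (input_matrix F) V"
  obtain C where C: "0 \<le> C" and rem: "\<And>x u. x \<in> K \<Longrightarrow> norm u \<le> 1 \<Longrightarrow>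
      norm (F x u - F x 0 - input_matrix F x *v u) \<le> C * (norm u)\<^sup>2"
    using control_remainder[OF F' C2 K] by auto
  obtain M where M: "0 < M" "\<And>x. x \<in> K \<Longrightarrow> norm (a x) \<le> M"
    using compact_norm_bound[OF K cont_LgV] unfolding a_def by blast
  obtain N where N: "0 < N" "\<And>x. x \<in> K \<Longrightarrow> norm (grad V x) \<le> N"
    using compact_norm_bound[OF K grad_V] by blast
  \<comment> \<open>The first bound keeps |u| \<le> 1, where the remainder estimate applies; the
    second gives N C t \<le> 1/2, with the added 1 excluding a zero denominator.\<close>
  define c where "c = min (1 / M) (1 / (2 * (N * C + 1)))"
  have NC: "0 \<le> N * C" using N C by simp
  have "0 < c" using M NC by (simp add: c_def add_nonneg_pos)
  moreover have "grad V x \<bullet> F x (- t *\<^sub>R a x) \<le> lie (drift F) V x - t / 2 * (norm (a x))\<^sup>2"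
    if x: "x \<in> K" and t: "t \<in> {0..c}" for x t
  proof -
    define u where "u = - t *\<^sub>R a x"
    have norm_u: "norm u = t * norm (a x)" using t by (simp add: u_def)
    have "t * norm (a x) \<le> (1 / M) * M"
      using t M x by (intro mult_mono) (auto simp: c_def)
    then have "norm u \<le> 1" using M by (simp add: norm_u)
    then have R: "norm (F x u - F x 0 - input_matrix F x *v u) \<le> C * (norm u)\<^sup>2" by (rule rem[OF x])
    have "grad V x \<bullet> (F x u - F x 0 - input_matrix F x *v u)
        \<le> norm (grad V x) * norm (F x u - F x 0 - input_matrix F x *v u)"
      by (rule norm_cauchy_schwarz)
    also have "\<dots> \<le> N * (C * (norm u)\<^sup>2)"
      using N x R by (intro mult_mono) auto
    also have "\<dots> = (N * C * t) * (t * (norm (a x))\<^sup>2)"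
      by (simp add: norm_u power2_eq_square mult_ac)
    also have "\<dots> \<le> 1 / 2 * (t * (norm (a x))\<^sup>2)"
    proof (rule mult_right_mono)
      have "N * C * t \<le> (N * C + 1) * (1 / (2 * (N * C + 1)))"
        using t NC by (intro mult_mono) (auto simp: c_def)
      also have "\<dots> = 1 / 2" using NC by (simp add: field_simps)
      finally show "N * C * t \<le> 1 / 2" .
    qed (use t in auto)
    finally have "grad V x \<bullet> (F x u - F x 0 - input_matrix F x *v u) \<le> t / 2 * (norm (a x))\<^sup>2"
      by simp
    moreover have "grad V x \<bullet> (input_matrix F x *v u) = - t * (norm (a x))\<^sup>2"
      by (simp add: a_def u_def dot_square_norm flip: lie_mat_inner)
    ultimately show ?thesis
      unfolding u_def[symmetric] by (simp add: lie_def drift_def inner_diff_right)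
  qed
  ultimately show ?thesis unfolding a_def by blast
qed

text \<open>Where q < 0 every positive d works. The rest of K is compact and N is positive on it, so
  N has a positive lower bound there against which d q can be made small.\<close>

lemma compact_dominate:
  fixes N q :: "'a::t2_space \<Rightarrow> real"
  assumes K: "compact K" and N: "continuous_on UNIV N" and q: "continuous_on UNIV q"
    and nonneg: "\<And>x. x \<in> K \<Longrightarrow> 0 \<le> N x"
    and neg: "\<And>x. x \<in> K \<Longrightarrow> N x = 0 \<Longrightarrow> q x < 0"
  shows "\<exists>c>0. \<forall>x\<in>K. \<forall>d\<in>{0<..c}. d * q x < N x / 2"
proof -
  define A where "A = K \<inter> {x. 0 \<le> q x}"
  have "compact A"
    unfolding A_def using q by (intro compact_Int_closed K closed_Collect_le) auto
  have pos: "0 < N x" if "x \<in> A" for x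
    using that nonneg[of x] neg[of x] by (force simp: A_def)
  have "\<exists>\<nu>>0. \<forall>x\<in>A. \<nu> \<le> N x"
  proof (cases "A = {}")
    case False
    then obtain y where "y \<in> A" "\<And>x. x \<in> A \<Longrightarrow> N y \<le> N x"
      using continuous_attains_inf[OF \<open>compact A\<close> _ continuous_on_subset[OF N]] by auto
    then show ?thesis using pos by blast
  qed (auto intro: exI[of _ 1])
  then obtain \<nu> where \<nu>: "0 < \<nu>" "\<And>x. x \<in> A \<Longrightarrow> \<nu> \<le> N x" by blast
  obtain M where M: "0 < M" "\<And>x. x \<in> K \<Longrightarrow> norm (q x) \<le> M"
    using compact_norm_bound[OF K q] by blast
  have "d * q x < N x / 2" if x: "x \<in> K" and d: "d \<in> {0<..\<nu> / (4 * M)}" for x d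
  proof (cases "0 \<le> q x")
    case True
    then have "x \<in> A" using x by (simp add: A_def)
    have "d * q x \<le> \<nu> / (4 * M) * M"
      using True d M x by (intro mult_mono) (auto, fastforce)
    also have "\<dots> < \<nu> / 2" using M \<nu> by simp
    finally show ?thesis using \<nu>(2)[OF \<open>x \<in> A\<close>] by simp
  next
    case False
    then have "d * q x < 0" using d by (simp add: mult_pos_neg)
    then show ?thesis using nonneg[OF x] by simp
  qed
  then show ?thesis using \<nu>(1) M(1) by (intro exI[of _ "\<nu> / (4 * M)"]) auto
qed

lemma continuous_lie_mat_input_matrix:
  fixes F :: "real^'n \<Rightarrow> real^'m \<Rightarrow> real^'n"
  assumes F': "\<And>z. ((\<lambda>(x, u). F x u) has_derivative F' z) (at z)"
    and cont_F': "\<And>v. continuous_on UNIV (\<lambda>z. F' z v)"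
    and grad_V: "continuous_on UNIV (grad V)"
  shows "continuous_on UNIV (lie_mat (input_matrix F) V)"
proof -
  have "lie_mat (input_matrix F) V x $ j = grad V x \<bullet> F' (x, 0) (0, axis j 1)" for x j
    using lie_mat_inner[of "input_matrix F" V x "axis j 1"]
    by (simp add: inner_axis input_matrix_mult[OF F'])
  then have "lie_mat (input_matrix F) V = (\<lambda>x. \<chi> j. grad V x \<bullet> F' (x, 0) (0, axis j 1))"
    by (simp add: fun_eq_iff vec_eq_iff)
  moreover have "continuous_on UNIV (\<lambda>x. F' (x, 0) v)" for v
    by (rule continuous_on_compose2[OF cont_F', of _ "\<lambda>x. (x, 0)"]) (auto intro!: continuous_intros)
  ultimately show ?thesis by (auto intro!: continuous_intros grad_V)
qed

text \<open>The order of the choices matters: \<open>\<xi>\<close> comes first and fixes the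
  feedback, hence N and q; then \<open>\<delta>\<close> is chosen small relative to these.\<close>

lemma strict_Lyapunov:
  fixes F :: "real^'n \<Rightarrow> real^'m \<Rightarrow> real^'n"
    and V :: "real^'n \<Rightarrow> real"
    and G :: "real^'n \<Rightarrow> real^'n"
  assumes F_C1: "Ck_on 1 UNIV (\<lambda>(x, u). F x u)"
    and F_0: "F 0 0 = 0"
    and F_C2: "C2_in_control F"
    and V_C2: "Ck_on 2 UNIV V"
    and V_pos: "positive_definite V"
    and V_unbounded: "radially_unbounded V"
    and A1: "\<And>x. lie (drift F) V x \<le> 0"
    and G_C1: "Ck_on 1 UNIV G"
    and A2: "\<And>x. x \<noteq> 0 \<Longrightarrow> lie_mat (input_matrix F) V x = 0 \<Longrightarrow>
      lie (drift F) (lie G V) x < 0 \<or> lie (drift F) V x < 0"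
    and cont_\<xi>\<^sub>b: "continuous_on {0..} \<xi>\<^sub>b"
    and \<xi>\<^sub>b_pos: "\<And>s. 0 \<le> s \<Longrightarrow> 0 < \<xi>\<^sub>b s"
  shows "\<exists>\<delta> \<Omega> \<xi>. admissible \<delta> \<Omega> \<and>
               Ck_on 1 {0..} \<xi> \<and> (\<forall>s\<ge>0. 0 < \<xi> s \<and> \<xi> s \<le> \<xi>\<^sub>b s) \<and>
               control_lyapunov F (V_sharp V G \<delta> \<Omega>) \<and>
               small_control_property F (V_sharp V G \<delta> \<Omega>) \<and>
               negative_definite (\<lambda>x. grad (V_sharp V G \<delta> \<Omega>) x \<bullet>
                 F x (- \<xi> (V x) *\<^sub>R lie_mat (input_matrix F) V x))"
proof -
  define a where "a = lie_mat (input_matrix F) V"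
  define L where "L = lie G V"
  obtain F' where F': "\<And>z. ((\<lambda>(x, u). F x u) has_derivative F' z) (at z)"
    and cont_F': "\<And>v. continuous_on UNIV (\<lambda>z. F' z v)"
    using F_C1 by auto
  have cont_F: "continuous_on UNIV (\<lambda>(x, u). F x u)"
    using F' has_derivative_continuous by (blast intro: continuous_at_imp_continuous_on)
  have "Ck_on 1 UNIV V"
  proof -
    obtain V' where "\<And>x. (V has_derivative V' x) (at x)" "\<And>v. Ck_on 1 UNIV (\<lambda>x. V' x v)"
      using V_C2 by (auto simp: numeral_2_eq_2)
    moreover from this(2) have "continuous_on UNIV (\<lambda>x. V' x v)" for v
      by (metis C1_iff_grad continuous_at_imp_continuous_on has_derivative_continuous)
    ultimately show ?thesis by auto
  qed
  then have V_deriv: "\<And>x. (V has_derivative (\<lambda>h. grad V x \<bullet> h)) (at x)"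
    and grad_V: "continuous_on UNIV (grad V)"
    unfolding C1_iff_grad by blast+
  have "Ck_on 1 UNIV L"
    unfolding L_def using V_C2 G_C1 by (rule C1_lie)
  then have L_deriv: "\<And>x. (L has_derivative (\<lambda>h. grad L x \<bullet> h)) (at x)"
    and grad_L: "continuous_on UNIV (grad L)"
    unfolding C1_iff_grad by blast+
  have cont_V: "continuous_on UNIV V" and cont_L: "continuous_on UNIV L"
    using V_deriv L_deriv has_derivative_continuous by (blast intro: continuous_at_imp_continuous_on)+
  have cont_a: "continuous_on UNIV a"
    unfolding a_def by (rule continuous_lie_mat_input_matrix[OF F' cont_F' grad_V])
  have V_0: "V 0 = 0" and V_gt: "\<And>x. x \<noteq> 0 \<Longrightarrow> 0 < V x"
    using V_pos by (auto simp: positive_definite_def)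
  then have V_ge: "0 \<le> V x" for x by (cases "x = 0") (auto intro: less_imp_le)
  note sublevel = compact_sublevel[OF cont_V V_unbounded]

  \<comment> \<open>The origin is a minimum of V. Hence the feedback vanishes there, as the small
    control property and the value 0 at the origin require.\<close>
  have grad_V_0: "grad V 0 = 0"
  proof -
    have "(\<lambda>h. grad V 0 \<bullet> h) = (\<lambda>h. 0)"
      by (rule has_derivative_local_min[OF V_deriv]) (simp add: V_0 V_ge)
    then show ?thesis by (metis inner_eq_zero_iff)
  qed
  then have a_0: "a 0 = 0"
    by (simp add: a_def lie_mat_def vector_matrix_mult_def vec_eq_iff)

  \<comment> \<open>Demanding the estimate for all gains up to c lets \<open>\<xi>\<close>, which
    lies below some such c, inherit it.\<close>
  define good where "good c x \<longleftrightarrow> (\<forall>t\<in>{0..c}.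
      grad V x \<bullet> F x (- t *\<^sub>R a x) \<le> lie (drift F) V x - t / 2 * (norm (a x))\<^sup>2)" for c x
  \<comment> \<open>The minorant lives on the open half-line, so it is shifted by one to be positive at 0.\<close>
  define B where "B s c \<longleftrightarrow> (1 \<le> s \<longrightarrow> c \<le> \<xi>\<^sub>b (s - 1) \<and> (\<forall>x. V x = s - 1 \<longrightarrow> good c x))" for s c
  have B_ex: "\<exists>c>0. \<forall>s\<in>{\<alpha>..\<beta>}. B s c" for \<alpha> \<beta>
  proof -
    obtain c where c: "0 < c" "\<And>x. V x \<le> \<beta> - 1 \<Longrightarrow> good c x"
      using damping_decrease[OF F' F_C2 sublevel[of "\<beta> - 1"] grad_V] cont_a
      unfolding good_def a_def by auto
    \<comment> \<open>The \<open>max\<close> keeps the interval nonempty when \<beta> < 1, so that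
      \<open>\<xi>\<^sub>b\<close> attains a minimum on it.\<close>
    have "continuous_on {0..max 0 (\<beta> - 1)} \<xi>\<^sub>b"
      using cont_\<xi>\<^sub>b by (rule continuous_on_subset) auto
    then obtain y where y: "y \<in> {0..max 0 (\<beta> - 1)}" "\<forall>s\<in>{0..max 0 (\<beta> - 1)}. \<xi>\<^sub>b y \<le> \<xi>\<^sub>b s"
      using continuous_attains_inf[of "{0..max 0 (\<beta> - 1)}" \<xi>\<^sub>b] by auto
    show ?thesis
      unfolding B_def
    proof (intro exI[of _ "min c (\<xi>\<^sub>b y)"] conjI ballI impI allI)
      show "0 < min c (\<xi>\<^sub>b y)" using c y \<xi>\<^sub>b_pos by auto
      show "min c (\<xi>\<^sub>b y) \<le> \<xi>\<^sub>b (s - 1)" if "s \<in> {\<alpha>..\<beta>}" "1 \<le> s" for s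
      proof -
        have "s - 1 \<in> {0..max 0 (\<beta> - 1)}" using that by auto
        then show ?thesis using y(2) by fastforce
      qed
      show "good (min c (\<xi>\<^sub>b y)) x" if "s \<in> {\<alpha>..\<beta>}" "V x = s - 1" for s x
        using c(2)[of x] that by (auto simp: good_def)
    qed
  qed
  obtain X where X_deriv: "\<And>k x. (X k has_real_derivative X (Suc k) x) (at x)"
    and X_pos: "\<And>s. 0 < s \<Longrightarrow> 0 < X 0 s"
    and X_B: "\<And>s. 0 < s \<Longrightarrow> \<exists>c. B s c \<and> X 0 s \<le> c \<and> \<bar>X 1 s\<bar> \<le> c"
    by (rule smooth_minorant[OF B_ex]) (rule that)
  define \<xi> where "\<xi> s = X 0 (s + 1)" for s
  have \<xi>_smooth: "smooth_on {0..} \<xi>"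
    using smooth_on_jet[of "\<lambda>k s. X k (s + 1)"] X_deriv DERIV_shift unfolding \<xi>_def by blast
  have \<xi>_pos: "0 < \<xi> s" if "0 \<le> s" for s
    using that X_pos by (simp add: \<xi>_def)
  have \<xi>_le: "\<xi> s \<le> \<xi>\<^sub>b s" if "0 \<le> s" for s
    using X_B[of "s + 1"] that by (auto simp: \<xi>_def B_def)
  have cont_\<xi>: "continuous_on UNIV \<xi>"
  proof -
    have "continuous_on UNIV (X 0)"
      by (intro continuous_at_imp_continuous_on ballI DERIV_isCont[OF X_deriv])
    then show ?thesis
      unfolding \<xi>_def by (rule continuous_on_compose2) (auto intro!: continuous_intros)
  qed
  define u where "u x = - \<xi> (V x) *\<^sub>R a x" for x
  have cont_u: "continuous_on UNIV u"
    unfolding u_def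
    by (intro continuous_intros cont_a cont_V continuous_on_compose2[OF cont_\<xi>]) auto
  have u_0: "u 0 = 0" by (simp add: u_def a_0)
  have cont_Fu: "continuous_on UNIV (\<lambda>x. F x (u x))"
    using continuous_on_compose2[OF cont_F, of UNIV "\<lambda>x. (x, u x)"] cont_u
    by (simp add: continuous_on_Pair)

  \<comment> \<open>Derivatives of V and of L_GV along the closed loop\<close>
  define N where "N x = - (grad V x \<bullet> F x (u x))" for x
  define q where "q x = grad L x \<bullet> F x (u x)" for x
  have cont_N: "continuous_on UNIV N" and cont_q: "continuous_on UNIV q"
    unfolding N_def q_def by (intro continuous_intros grad_V grad_L cont_Fu)+
  have N_ge: "\<xi> (V x) / 2 * (norm (a x))\<^sup>2 - lie (drift F) V x \<le> N x" for x
  proof -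
    obtain c where "good c x" "\<xi> (V x) \<le> c"
      using X_B[of "V x + 1"] V_ge[of x] by (auto simp: \<xi>_def B_def)
    moreover have "\<xi> (V x) \<in> {0..c}" using \<open>\<xi> (V x) \<le> c\<close> \<xi>_pos[OF V_ge[of x]] by simp
    ultimately show ?thesis by (force simp: good_def N_def u_def)
  qed
  have damp_ge: "0 \<le> \<xi> (V x) / 2 * (norm (a x))\<^sup>2" for x
    using \<xi>_pos[OF V_ge[of x]] by simp
  have N_nonneg: "0 \<le> N x" for x
    using N_ge[of x] damp_ge[of x] A1[of x] by linarith
  have q_neg: "q x < 0" if "x \<noteq> 0" "N x = 0" for x
  proof -
    \<comment> \<open>N dominates a sum of two nonnegative terms, so both vanish with it. Then u =
      0, and L_fV = 0 leaves only the first alternative of \<open>A2\<close>.\<close>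
    have "\<xi> (V x) / 2 * (norm (a x))\<^sup>2 = 0" "lie (drift F) V x = 0"
      using N_ge[of x] damp_ge[of x] A1[of x] that by linarith+
    then have "a x = 0" using \<xi>_pos[OF V_ge[of x]] by simp
    moreover from this have "lie (drift F) L x < 0"
      using A2[OF \<open>x \<noteq> 0\<close>] \<open>lie (drift F) V x = 0\<close> by (simp add: a_def L_def)
    ultimately show ?thesis by (simp add: q_def u_def lie_def drift_def)
  qed

  \<comment> \<open>The clauses serve in turn to keep the new function above V/2, to keep the factor
    1 + \<open>\<delta>\<close>'(V) L_GV at least 1/2, and to make \<open>\<delta>\<close>(V) q less
    than N/2. Quantifying over d lets \<open>\<delta>\<close>(V) inherit the last one.\<close>
  define small where "small c x \<longleftrightarrow> c * \<bar>L x\<bar> \<le> V x / 2 \<and> c * \<bar>L x\<bar> \<le> 1 / 2 \<and>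
      (\<forall>d\<in>{0<..c}. d * q x < N x / 2)" for c x
  define B' where "B' s c \<longleftrightarrow> (\<forall>x. V x = s \<longrightarrow> small c x)" for s c
  have B'_ex: "\<exists>c>0. \<forall>s\<in>{\<alpha>..\<beta>}. B' s c" if "0 < \<alpha>" for \<alpha> \<beta>
  proof -
    \<comment> \<open>On this annulus the origin is excluded, so q < 0 wherever N = 0 and one
      constant serves all its points.\<close>
    define K where "K = {x. V x \<le> \<beta>} \<inter> {x. \<alpha> \<le> V x}"
    have K: "compact K"
      unfolding K_def using cont_V by (intro compact_Int_closed sublevel closed_Collect_le) auto
    have K_nonzero: "x \<noteq> 0" if "x \<in> K" for x using that \<open>0 < \<alpha>\<close> V_0 by (auto simp: K_def)
    obtain c where c: "0 < c" "\<And>x d. x \<in> K \<Longrightarrow> d \<in> {0<..c} \<Longrightarrow> d * q x < N x / 2"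
      using compact_dominate[OF K cont_N cont_q] N_nonneg q_neg K_nonzero by metis
    obtain M where M: "0 < M" "\<And>x. x \<in> K \<Longrightarrow> norm (L x) \<le> M"
      using compact_norm_bound[OF K cont_L] by blast
    \<comment> \<open>On the annulus V \<ge> \<alpha>, so \<alpha>/2 stands in for V/2 in the first
      clause.\<close>
    define e where "e = min c (min (\<alpha> / 2) (1 / 2) / M)"
    have "0 < e" using c M that by (simp add: e_def)
    moreover have "small e x" if "x \<in> K" for x
    proof -
      have "e * \<bar>L x\<bar> \<le> min (\<alpha> / 2) (1 / 2) / M * M"
        using M that \<open>0 < \<alpha>\<close> by (intro mult_mono) (auto simp: e_def)
      then have "e * \<bar>L x\<bar> \<le> min (\<alpha> / 2) (1 / 2)" using M by simp
      moreover have "\<alpha> \<le> V x" using that by (simp add: K_def)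
      ultimately show ?thesis
        using c(2)[OF that] by (auto simp: small_def e_def)
    qed
    ultimately show ?thesis by (intro exI[of _ e]) (auto simp: K_def B'_def)
  qed
  obtain D where D_deriv: "\<And>k x. (D k has_real_derivative D (Suc k) x) (at x)"
    and D_0: "\<And>s. s \<le> 0 \<Longrightarrow> D 0 s = 0"
    and D_pos: "\<And>s. 0 < s \<Longrightarrow> 0 < D 0 s"
    and D_small: "\<And>s. 0 < s \<Longrightarrow> \<exists>c. B' s c \<and> D 0 s \<le> c \<and> \<bar>D 1 s\<bar> \<le> c"
    by (rule smooth_minorant[of B', OF B'_ex]) (assumption | rule that)+
  define \<delta> where "\<delta> = D 0"
  \<comment> \<open>With \<open>\<Omega>\<close> zero the integral vanishes; positivity comes from
    the smallness of \<open>\<delta>\<close>(V) L_GV relative to V.\<close>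
  define W where "W = V_sharp V G \<delta> (\<lambda>_. 0)"
  have W_eq: "W x = V x + \<delta> (V x) * L x" for x
    by (simp add: W_def V_sharp_def L_def)
  have \<delta>: "0 < \<delta> (V x)" "\<bar>\<delta> (V x) * L x\<bar> \<le> V x / 2" "\<bar>D 1 (V x) * L x\<bar> \<le> 1 / 2"
    "\<delta> (V x) * q x < N x / 2" if "x \<noteq> 0" for x
  proof -
    obtain c where c: "small c x" "\<delta> (V x) \<le> c" "\<bar>D 1 (V x)\<bar> \<le> c"
      using D_small[OF V_gt[OF \<open>x \<noteq> 0\<close>]] by (auto simp: \<delta>_def B'_def)
    show pos: "0 < \<delta> (V x)" using D_pos[OF V_gt[OF that]] by (simp add: \<delta>_def)
    have "\<bar>\<delta> (V x)\<bar> * \<bar>L x\<bar> \<le> c * \<bar>L x\<bar>" "\<bar>D 1 (V x)\<bar> * \<bar>L x\<bar> \<le> c * \<bar>L x\<bar>"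
      using c pos by (auto intro: mult_right_mono)
    then show "\<bar>\<delta> (V x) * L x\<bar> \<le> V x / 2" "\<bar>D 1 (V x) * L x\<bar> \<le> 1 / 2"
      using c(1) by (auto simp: small_def abs_mult)
    show "\<delta> (V x) * q x < N x / 2" using c pos by (auto simp: small_def)
  qed
  have W_ge: "V x / 2 \<le> W x" for x
  proof (cases "x = 0")
    case False
    then show ?thesis using \<delta>(2)[OF False] unfolding W_eq by linarith
  qed (simp add: W_eq V_0 \<delta>_def D_0)

  \<comment> \<open>Gradient of the new function and its decrease along the closed loop\<close>
  have W_deriv: "(W has_derivative
      (\<lambda>h. ((1 + D 1 (V x) * L x) *\<^sub>R grad V x + \<delta> (V x) *\<^sub>R grad L x) \<bullet> h)) (at x)" for x
  proof -
    have "((\<lambda>x. \<delta> (V x)) has_derivative (\<lambda>h. D 1 (V x) * (grad V x \<bullet> h))) (at x)"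
      using has_derivative_compose[OF V_deriv D_deriv[of 0, unfolded has_field_derivative_def]]
      by (simp add: \<delta>_def)
    then have "((\<lambda>x. V x + \<delta> (V x) * L x) has_derivative
        (\<lambda>h. grad V x \<bullet> h + (\<delta> (V x) * (grad L x \<bullet> h) + D 1 (V x) * (grad V x \<bullet> h) * L x))) (at x)"
      by (intro has_derivative_add has_derivative_mult V_deriv L_deriv)
    then show ?thesis
      by (simp add: W_eq[abs_def] inner_add_left algebra_simps)
  qed
  have grad_W: "grad W x = (1 + D 1 (V x) * L x) *\<^sub>R grad V x + \<delta> (V x) *\<^sub>R grad L x" for x
    using inner_grad[OF W_deriv] by (subst vector_eq_rdot[symmetric]) blast
  have cont_D: "continuous_on UNIV (\<lambda>x. D k (V x))" for k
  proof -
    have "continuous_on UNIV (D k)"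
      by (intro continuous_at_imp_continuous_on ballI DERIV_isCont[OF D_deriv])
    then show ?thesis by (rule continuous_on_compose2[OF _ cont_V]) auto
  qed
  have "continuous_on UNIV (grad W)"
    unfolding grad_W[abs_def] \<delta>_def by (intro continuous_intros cont_D cont_L grad_V grad_L)
  then have W_C1: "Ck_on 1 UNIV W"
    unfolding C1_iff_grad using W_deriv by (simp only: grad_W) blast
  have W_decr: "grad W x \<bullet> F x (u x) < 0" if "x \<noteq> 0" for x
  proof -
    \<comment> \<open>The V-part contributes at most -N/2 and the \<open>\<delta>\<close>-part is
      strictly below N/2, so the sum is strictly negative even where N = 0.\<close>
    have "1 / 2 * N x \<le> (1 + D 1 (V x) * L x) * N x"
      using \<delta>(3)[OF that] N_nonneg by (intro mult_right_mono) linarith+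
    moreover have "grad W x \<bullet> F x (u x) = - ((1 + D 1 (V x) * L x) * N x) + \<delta> (V x) * q x"
      by (simp add: grad_W inner_add_left N_def q_def)
    ultimately show ?thesis using \<delta>(4)[OF that] by linarith
  qed

  \<comment> \<open>Verification of the required properties\<close>
  have "admissible \<delta> (\<lambda>_. 0)"
    unfolding admissible_def positive_definite_halfline_def \<delta>_def
    using smooth_on_jet[of D, OF D_deriv] D_0 D_pos by (auto simp: integrable_0)
  moreover have "Ck_on 1 {0..} \<xi>"
    using \<xi>_smooth by (simp only: smooth_on_def)
  moreover have "control_lyapunov F W"
    unfolding control_lyapunov_def
  proof (intro conjI allI impI)
    show "positive_definite W"
      unfolding positive_definite_def
    proof (intro conjI allI impI)
      show "W 0 = 0" by (simp add: W_eq V_0 \<delta>_def D_0)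
      show "0 < W x" if "x \<noteq> 0" for x using V_gt[OF that] W_ge[of x] by linarith
    qed
    have "filterlim (\<lambda>x. 1 / 2 * V x) at_top at_infinity"
      using V_unbounded unfolding radially_unbounded_def
      by (intro filterlim_tendsto_pos_mult_at_top[OF tendsto_const]) auto
    then show "radially_unbounded W"
      unfolding radially_unbounded_def
      by (rule filterlim_at_top_mono) (use W_ge in simp)
    show "\<exists>u. grad W x \<bullet> F x u < 0" if "x \<noteq> 0" for x
      using W_decr[OF that] by blast
  qed (rule W_C1)
  \<comment> \<open>The feedback itself is the small control: it is continuous and vanishes at the
    origin.\<close>
  moreover have "small_control_property F W"
    unfolding small_control_property_def
  proof (intro allI impI)
    fix \<epsilon> :: real assume "0 < \<epsilon>"
    moreover have "isCont u 0" using cont_u by (simp add: continuous_on_eq_continuous_at)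
    ultimately obtain \<eta> where \<eta>: "0 < \<eta>" "\<And>x. norm x < \<eta> \<Longrightarrow> norm (u x) < \<epsilon>"
      using u_0 by (auto simp: continuous_at_eps_delta)
    then show "\<exists>\<eta>>0. \<forall>x. 0 < norm x \<and> norm x < \<eta> \<longrightarrow> (\<exists>u. norm u < \<epsilon> \<and> grad W x \<bullet> F x u < 0)"
      using W_decr by (intro exI[of _ \<eta>]) auto
  qed
  moreover have "negative_definite (\<lambda>x. grad W x \<bullet> F x (u x))"
    using W_decr by (simp add: negative_definite_def positive_definite_def u_0 F_0)
  ultimately show ?thesis
    using \<xi>_pos \<xi>_le unfolding W_def u_def a_def by blast
qed

theorem theorem1:
  fixes F :: "real^'n \<Rightarrow> real^'m \<Rightarrow> real^'n"
    and V :: "real^'n \<Rightarrow> real"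
    and G :: "real^'n \<Rightarrow> real^'n"
  assumes F_C1: "Ck_on 1 UNIV (\<lambda>(x, u). F x u)"
    and F_0: "F 0 0 = 0"
    and F_C2: "C2_in_control F"
    and V_smooth: "smooth_on UNIV V"
    and V_pos: "positive_definite V"
    and V_unbounded: "radially_unbounded V"
    and A1: "\<And>x. lie (drift F) V x \<le> 0"
    and G_C1: "Ck_on 1 UNIV G"
    and A2: "\<And>x. x \<noteq> 0 \<Longrightarrow> lie_mat (input_matrix F) V x = 0 \<Longrightarrow>
      lie (drift F) (lie G V) x < 0 \<or> lie (drift F) V x < 0"
  shows "(\<exists>\<delta> \<Omega>. admissible \<delta> \<Omega> \<and>
            control_lyapunov F (V_sharp V G \<delta> \<Omega>) \<and>
            small_control_property F (V_sharp V G \<delta> \<Omega>)) \<and>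
         (\<forall>\<xi>\<^sub>b. Ck_on 1 {0..} \<xi>\<^sub>b \<and> (\<forall>s\<ge>0. \<xi>\<^sub>b s > 0) \<longrightarrow>
            (\<exists>\<delta> \<Omega> \<xi>. admissible \<delta> \<Omega> \<and>
               Ck_on 1 {0..} \<xi> \<and> (\<forall>s\<ge>0. 0 < \<xi> s \<and> \<xi> s \<le> \<xi>\<^sub>b s) \<and>
               control_lyapunov F (V_sharp V G \<delta> \<Omega>) \<and>
               small_control_property F (V_sharp V G \<delta> \<Omega>) \<and>
               negative_definite (\<lambda>x. grad (V_sharp V G \<delta> \<Omega>) x \<bullet>
                 F x (- \<xi> (V x) *\<^sub>R lie_mat (input_matrix F) V x))))"
proof -
  have "Ck_on 2 UNIV V" using V_smooth by (simp only: smooth_on_def)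
  note strict = strict_Lyapunov[OF F_C1 F_0 F_C2 this V_pos V_unbounded A1 G_C1 A2]
  show ?thesis
  proof (intro conjI allI impI)
    show "\<exists>\<delta> \<Omega>. admissible \<delta> \<Omega> \<and> control_lyapunov F (V_sharp V G \<delta> \<Omega>) \<and>
        small_control_property F (V_sharp V G \<delta> \<Omega>)"
      \<comment> \<open>Any positive continuous bound on the gain yields the first claim; the
        constant 1 is taken.\<close>
      using strict[of "\<lambda>_. 1"] by auto
  next
    fix \<xi>\<^sub>b :: "real \<Rightarrow> real"
    assume \<xi>\<^sub>b: "Ck_on 1 {0..} \<xi>\<^sub>b \<and> (\<forall>s\<ge>0. \<xi>\<^sub>b s > 0)"
    then have "continuous_on {0..} \<xi>\<^sub>b"
      by (auto simp: continuous_on_eq_continuous_within intro: has_derivative_continuous)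
    then show "\<exists>\<delta> \<Omega> \<xi>. admissible \<delta> \<Omega> \<and>
        Ck_on 1 {0..} \<xi> \<and> (\<forall>s\<ge>0. 0 < \<xi> s \<and> \<xi> s \<le> \<xi>\<^sub>b s) \<and>
        control_lyapunov F (V_sharp V G \<delta> \<Omega>) \<and>
        small_control_property F (V_sharp V G \<delta> \<Omega>) \<and>
        negative_definite (\<lambda>x. grad (V_sharp V G \<delta> \<Omega>) x \<bullet>
          F x (- \<xi> (V x) *\<^sub>R lie_mat (input_matrix F) V x))"
      using \<xi>\<^sub>b by (intro strict) auto
  qed
qed

end
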